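(* Let $\mathbb{F}$ be a field and let $M:(\mathbb{R},\leq)^2\to \mathbf{vect}_{\mathbb{F}}$ be a pointwise finite-dimensional 2-parameter persistence module. Assume there exists a finite convex isotopy subdivision of $(\mathbb{R},\leq)^2$ subordinate to $M$, and fix one. Then $M\cong N$, where $N:(\mathbb{R},\leq)^2\to\mathbf{vect}_{\mathbb{F}}$ is the functor defined as follows: (i) for every chamber $J$ and every $j\in J$, $Nj=\lim_J M$; (ii) for all $j_1\leq j_2$, with $J_1$ the chamber containing $j_1$ and $J_2$ the chamber containing $j_2$, the map $N(j_1\leq j_2):Nj_1\to Nj_2$ is $\mathrm{id}_{\lim_J M}$ if $J:=J_1=J_2$, and is $\phi_{J_1J_2}$ otherwise.
   Context: $\mathbf{vect}_{\mathbb{F}}$ is the category of finite-dimensional $\mathbb{F}$-vector spaces. $(\mathbb{R},\leq)^2$ is $\mathbb{R}^2$ with the product order, viewed as a category. A pointwise finite-dimensional 2-parameter persistence module is a functor $M:(\mathbb{R},\leq)^2\to\mathbf{vect}_{\mathbb{F}}$; its value at $i$ is $Mi$ and its structure maps are $M(i\leq j):Mi\to Mj$. A subset $I$ of a poset is convex if $i,k\in I$ and $i\leq j\leq k$ imply $j\in I$. It is connected if for all $a,b\in I$ there exist $x_0=a,x_1,\dots,x_n=b$ in $I$ such that $x_i$ and $x_{i+1}$ are comparable for each $i$. An isotopy subdivision of $(\mathbb{R},\leq)^2$ subordinate to $M$ is a partition of $\mathbb{R}^2$ into connected subsets (called chambers) such that $M(a\leq b)$ is an isomorphism whenever $a\leq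 b$ lie in the same chamber. It is finite if there are finitely many chambers, and convex if every chamber is convex. $\lim_J M$ denotes the limit of the restriction $M|_J$ of $M$ to the subposet $J$. For a chamber $J$, all leg maps $\lim_J M\to Mj$ ($j\in J$) of the limit cone are isomorphisms. If $J_1\neq J_2$ are chambers and there exist $a\in J_1$, $b\in J_2$ with $a\leq b$, then $\phi_{J_1J_2}:\lim_{J_1}M\to\lim_{J_2}M$ is defined by $\phi_{J_1J_2}=\tau_b^{-1}\circ M(a\leq b)\circ\sigma_a$, where $\sigma_a:\lim_{J_1}M\to Ma$ and $\tau_b:\lim_{J_2}M\to Mb$ are the leg maps of the limit cones; this does not depend on the choice of such $a\leq b$. *)

theory Defs
  imports
    Complex_Main
    "HOL-Library.Disjoint_Sets"
    "HOL-Library.FuncSet"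
    "HOL-Library.Product_Order"
    "Jordan_Normal_Form.Missing_VectorSpace"
begin

text \<open>
  Vector spaces are the carrier-based ones of \<^locale>\<open>vectorspace\<close>, so a linear map is a HOL
  function whose values matter only on the carrier of its source; accordingly equations between
  linear maps are stated on carriers. The order on \<^typ>\<open>real \<times> real\<close> is the product order of
  \<^theory>\<open>HOL-Library.Product_Order\<close>.
\<close>

definition order_convex :: "'p::order set \<Rightarrow> bool"
  where "order_convex I \<longleftrightarrow> (\<forall>i\<in>I. \<forall>k\<in>I. \<forall>j. i \<le> j \<and> j \<le> k \<longrightarrow> j \<in> I)"

definition order_connected :: "'p::order set \<Rightarrow> bool"
  where "order_connected I \<longleftrightarrow> (\<forall>a\<in>I. \<forall>b\<in>I. \<exists>(n::nat) x.
    x 0 = a \<and> x n = b \<and> (\<forall>i\<le>n. x i \<in> I) \<and> (\<forall>i<n. x i \<le> x (Suc i) \<or> x (Suc i) \<le> x i))"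

definition vs_iso ::
    "('k, 'm) ring_scheme \<Rightarrow> ('k, 'v, 'a) module_scheme \<Rightarrow> ('k, 'w, 'b) module_scheme \<Rightarrow>
      ('v \<Rightarrow> 'w) \<Rightarrow> bool"
  where "vs_iso K V W f \<longleftrightarrow> linear_map K V W f \<and> bij_betw f (carrier V) (carrier W)"

record ('p, 'k, 'v) pers_mod =
  obj :: "'p \<Rightarrow> ('k, 'v) module"
  str :: "'p \<Rightarrow> 'p \<Rightarrow> 'v \<Rightarrow> 'v"  \<comment> \<open>\<open>str M i j\<close> is only meaningful for \<open>i \<le> j\<close>\<close>

locale pfd_pers_mod =
  fixes K :: "('k, 'm) ring_scheme" and M :: "('p::order, 'k, 'v) pers_mod"
  assumes vectorspace_obj: "\<And>i. vectorspace K (obj M i)"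
    and fin_dim_obj: "\<And>i. vectorspace.fin_dim K (obj M i)"
    and linear_str: "\<And>i j. i \<le> j \<Longrightarrow> linear_map K (obj M i) (obj M j) (str M i j)"
    and str_id: "\<And>i x. x \<in> carrier (obj M i) \<Longrightarrow> str M i i x = x"
    and str_comp: "\<And>i j k x. i \<le> j \<Longrightarrow> j \<le> k \<Longrightarrow> x \<in> carrier (obj M i) \<Longrightarrow>
      str M j k (str M i j x) = str M i k x"

definition pers_mod_isomorphic ::
    "('k, 'm) ring_scheme \<Rightarrow> ('p::order, 'k, 'v) pers_mod \<Rightarrow> ('p, 'k, 'w) pers_mod \<Rightarrow> bool"
  where "pers_mod_isomorphic K M N \<longleftrightarrow> (\<exists>\<eta>.
    (\<forall>i. vs_iso K (obj M i) (obj N i) (\<eta> i)) \<and>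
    (\<forall>i j. i \<le> j \<longrightarrow> (\<forall>x\<in>carrier (obj M i). \<eta> j (str M i j x) = str N i j (\<eta> i x))))"

definition isotopy_subdivision ::
    "('k, 'm) ring_scheme \<Rightarrow> ('p::order, 'k, 'v) pers_mod \<Rightarrow> 'p set set \<Rightarrow> bool"
  where "isotopy_subdivision K M P \<longleftrightarrow> partition_on UNIV P \<and> (\<forall>J\<in>P. order_connected J) \<and>
    (\<forall>J\<in>P. \<forall>a\<in>J. \<forall>b\<in>J. a \<le> b \<longrightarrow> vs_iso K (obj M a) (obj M b) (str M a b))"

text \<open>
  The limit of \<open>M\<close> restricted to \<open>J\<close>, realised as the space of compatible families with pointwise
  operations. The fields \<open>mult\<close> and \<open>one\<close> are inherited from the record type and play no
  role for modules.
\<close>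

definition lim_mod :: "('p::order, 'k, 'v) pers_mod \<Rightarrow> 'p set \<Rightarrow> ('k, 'p \<Rightarrow> 'v) module"
  where "lim_mod M J =
    \<lparr>carrier = {x \<in> \<Pi>\<^sub>E j\<in>J. carrier (obj M j). \<forall>i\<in>J. \<forall>j\<in>J. i \<le> j \<longrightarrow> str M i j (x i) = x j},
     mult = (\<lambda>x y. \<lambda>j\<in>J. x j \<otimes>\<^bsub>obj M j\<^esub> y j),
     one = (\<lambda>j\<in>J. \<one>\<^bsub>obj M j\<^esub>),
     zero = (\<lambda>j\<in>J. \<zero>\<^bsub>obj M j\<^esub>),
     add = (\<lambda>x y. \<lambda>j\<in>J. x j \<oplus>\<^bsub>obj M j\<^esub> y j),
     smult = (\<lambda>c x. \<lambda>j\<in>J. c \<odot>\<^bsub>obj M j\<^esub> x j)\<rparr>"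

definition leg :: "'p \<Rightarrow> ('p \<Rightarrow> 'v) \<Rightarrow> 'v"
  where "leg j x = x j"

text \<open>
  The pair \<open>a \<le> b\<close> is chosen by \<open>SOME\<close>. The map is used only for distinct chambers of a convex
  isotopy subdivision of the plane that contain such a pair; there the leg maps are isomorphisms
  and the map does not depend on the choice.
\<close>

definition lim_transition ::
    "('p::order, 'k, 'v) pers_mod \<Rightarrow> 'p set \<Rightarrow> 'p set \<Rightarrow> ('p \<Rightarrow> 'v) \<Rightarrow> ('p \<Rightarrow> 'v)"
  where "lim_transition M J1 J2 =
    (let (a, b) = (SOME (a, b). a \<in> J1 \<and> b \<in> J2 \<and> a \<le> b)
     in inv_into (carrier (lim_mod M J2)) (leg b) \<circ> str M a b \<circ> leg a)"

definition chamber_of :: "'p set set \<Rightarrow> 'p \<Rightarrow> 'p set"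
  where "chamber_of P j = (THE J. J \<in> P \<and> j \<in> J)"

definition chamber_model ::
    "('p::order, 'k, 'v) pers_mod \<Rightarrow> 'p set set \<Rightarrow> ('p, 'k, 'p \<Rightarrow> 'v) pers_mod"
  where "chamber_model M P =
    \<lparr>obj = (\<lambda>j. lim_mod M (chamber_of P j)),
     str = (\<lambda>j1 j2. if chamber_of P j1 = chamber_of P j2 then id
                    else lim_transition M (chamber_of P j1) (chamber_of P j2))\<rparr>"

text \<open>
  \<^const>\<open>lim_mod\<close> with the maps \<^const>\<open>leg\<close> is a limit cone in the category of vector spaces.
\<close>

lemma lim_mod_simps:
  "x \<in> carrier (lim_mod M J) \<longleftrightarrow> x \<in> (\<Pi>\<^sub>E j\<in>J. carrier (obj M j)) \<and>
     (\<forall>i\<in>J. \<forall>j\<in>J. i \<le> j \<longrightarrow> str M i j (x i) = x j)"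
  "\<zero>\<^bsub>lim_mod M J\<^esub> = (\<lambda>j\<in>J. \<zero>\<^bsub>obj M j\<^esub>)"
  "x \<oplus>\<^bsub>lim_mod M J\<^esub> y = (\<lambda>j\<in>J. x j \<oplus>\<^bsub>obj M j\<^esub> y j)"
  "c \<odot>\<^bsub>lim_mod M J\<^esub> x = (\<lambda>j\<in>J. c \<odot>\<^bsub>obj M j\<^esub> x j)"
  by (simp_all add: lim_mod_def)

lemma lim_mod_apply:
  assumes "j \<in> J"
  shows "\<zero>\<^bsub>lim_mod M J\<^esub> j = \<zero>\<^bsub>obj M j\<^esub>"
    and "(x \<oplus>\<^bsub>lim_mod M J\<^esub> y) j = x j \<oplus>\<^bsub>obj M j\<^esub> y j"
    and "(c \<odot>\<^bsub>lim_mod M J\<^esub> x) j = c \<odot>\<^bsub>obj M j\<^esub> x j"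
  using assms by (simp_all add: lim_mod_simps)

context pfd_pers_mod
begin

lemma module_obj: "module K (obj M i)"
  using vectorspace_obj[of i] by (simp add: vectorspace_def)

lemma abelian_group_obj: "abelian_group (obj M i)"
  using module_obj[of i] by (simp add: module_def)

lemma field_K: "field K"
  using vectorspace_obj[of undefined] by (simp add: vectorspace_def)

lemma str_in:
  assumes "i \<le> j" "x \<in> carrier (obj M i)"
  shows "str M i j x \<in> carrier (obj M j)"
proof -
  interpret linear_map K "obj M i" "obj M j" "str M i j" by (rule linear_str[OF assms(1)])
  show ?thesis using assms(2) by simp
qed

lemma str_add:
  assumes "i \<le> j" "x \<in> carrier (obj M i)" "y \<in> carrier (obj M i)"
  shows "str M i j (x \<oplus>\<^bsub>obj M i\<^esub> y) = str M i j x \<oplus>\<^bsub>obj M j\<^esub> str M i j y"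
proof -
  interpret linear_map K "obj M i" "obj M j" "str M i j" by (rule linear_str[OF assms(1)])
  show ?thesis using assms by simp
qed

lemma str_smult:
  assumes "i \<le> j" "c \<in> carrier K" "x \<in> carrier (obj M i)"
  shows "str M i j (c \<odot>\<^bsub>obj M i\<^esub> x) = c \<odot>\<^bsub>obj M j\<^esub> str M i j x"
proof -
  interpret linear_map K "obj M i" "obj M j" "str M i j" by (rule linear_str[OF assms(1)])
  show ?thesis using assms by simp
qed

lemma str_zero:
  assumes "i \<le> j"
  shows "str M i j \<zero>\<^bsub>obj M i\<^esub> = \<zero>\<^bsub>obj M j\<^esub>"
proof -
  interpret linear_map K "obj M i" "obj M j" "str M i j" by (rule linear_str[OF assms])
  show ?thesis by simp
qed

lemma lim_mod_ext:
  assumes "x \<in> carrier (lim_mod M J)" "y \<in> carrier (lim_mod M J)" "\<And>j. j \<in> J \<Longrightarrow> x j = y j"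
  shows "x = y"
  using assms by (auto simp: lim_mod_simps intro: PiE_ext)

lemma lim_mod_in:
  assumes "x \<in> carrier (lim_mod M J)" "j \<in> J"
  shows "x j \<in> carrier (obj M j)"
  using assms by (auto simp: lim_mod_simps)

lemma lim_mod_str:
  assumes "x \<in> carrier (lim_mod M J)" "i \<in> J" "j \<in> J" "i \<le> j"
  shows "str M i j (x i) = x j"
  using assms by (simp add: lim_mod_simps)

lemma lim_mod_add_in:
  assumes "x \<in> carrier (lim_mod M J)" "y \<in> carrier (lim_mod M J)"
  shows "x \<oplus>\<^bsub>lim_mod M J\<^esub> y \<in> carrier (lim_mod M J)"
  unfolding lim_mod_simps(1,3)
  using lim_mod_in[OF assms(1)] lim_mod_in[OF assms(2)]
  by (auto simp: str_add lim_mod_str[OF assms(1)] lim_mod_str[OF assms(2)]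
      intro!: abelian_monoid.a_closed abelian_group.axioms(1) abelian_group_obj)

lemma lim_mod_smult_in:
  assumes "c \<in> carrier K" "x \<in> carrier (lim_mod M J)"
  shows "c \<odot>\<^bsub>lim_mod M J\<^esub> x \<in> carrier (lim_mod M J)"
  unfolding lim_mod_simps(1,4)
  using assms(1) lim_mod_in[OF assms(2)]
  by (auto simp: str_smult lim_mod_str[OF assms(2)] intro!: module.smult_closed[OF module_obj])

lemma lim_mod_zero_in: "\<zero>\<^bsub>lim_mod M J\<^esub> \<in> carrier (lim_mod M J)"
  using abelian_group_obj
  by (auto simp: lim_mod_simps str_zero intro!: abelian_monoid.zero_closed
      dest: abelian_group.axioms(1))

lemma vectorspace_lim_mod: "vectorspace K (lim_mod M J)"
proof -
  let ?L = "lim_mod M J"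
  interpret K: field K by (rule field_K)
  note mem = lim_mod_in lim_mod_add_in lim_mod_smult_in lim_mod_zero_in
  have m: "abelian_monoid (obj M i)" for i
    using abelian_group_obj by (rule abelian_group.axioms(1))
  have neg: "\<exists>y\<in>carrier ?L. y \<oplus>\<^bsub>?L\<^esub> x = \<zero>\<^bsub>?L\<^esub>" if x: "x \<in> carrier ?L" for x
  proof (rule bexI[of _ "(\<ominus>\<^bsub>K\<^esub> \<one>\<^bsub>K\<^esub>) \<odot>\<^bsub>?L\<^esub> x"])
    show mx: "(\<ominus>\<^bsub>K\<^esub> \<one>\<^bsub>K\<^esub>) \<odot>\<^bsub>?L\<^esub> x \<in> carrier ?L"
      using x by (intro lim_mod_smult_in) auto
    show "(\<ominus>\<^bsub>K\<^esub> \<one>\<^bsub>K\<^esub>) \<odot>\<^bsub>?L\<^esub> x \<oplus>\<^bsub>?L\<^esub> x = \<zero>\<^bsub>?L\<^esub>"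
    proof (rule lim_mod_ext)
      fix j assume j: "j \<in> J"
      interpret V: module K "obj M j" by (rule module_obj)
      have xj: "x j \<in> carrier (obj M j)" using lim_mod_in[OF x j] .
      have "(\<ominus>\<^bsub>K\<^esub> \<one>\<^bsub>K\<^esub>) \<odot>\<^bsub>obj M j\<^esub> x j = \<ominus>\<^bsub>obj M j\<^esub> x j"
        using V.smult_l_minus[of "\<one>\<^bsub>K\<^esub>" "x j"] xj by simp
      then show "((\<ominus>\<^bsub>K\<^esub> \<one>\<^bsub>K\<^esub>) \<odot>\<^bsub>?L\<^esub> x \<oplus>\<^bsub>?L\<^esub> x) j = \<zero>\<^bsub>?L\<^esub> j"
        using j xj by (simp add: lim_mod_apply V.M.l_neg)
    qed (use x mx mem in auto)
  qed
  have ag: "abelian_group ?L"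
  proof (rule abelian_groupI)
    fix x y z assume x: "x \<in> carrier ?L" and y: "y \<in> carrier ?L" and z: "z \<in> carrier ?L"
    show "x \<oplus>\<^bsub>?L\<^esub> y \<oplus>\<^bsub>?L\<^esub> z = x \<oplus>\<^bsub>?L\<^esub> (y \<oplus>\<^bsub>?L\<^esub> z)"
      by (rule lim_mod_ext[of _ J])
        (use x y z in \<open>simp_all add: lim_mod_apply mem abelian_monoid.a_assoc[OF m]\<close>)
  next
    fix x y assume x: "x \<in> carrier ?L" and y: "y \<in> carrier ?L"
    show "x \<oplus>\<^bsub>?L\<^esub> y = y \<oplus>\<^bsub>?L\<^esub> x"
      by (rule lim_mod_ext[of _ J])
        (use x y in \<open>simp_all add: lim_mod_apply mem abelian_monoid.a_comm[OF m]\<close>)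
  next
    fix x assume x: "x \<in> carrier ?L"
    show "\<zero>\<^bsub>?L\<^esub> \<oplus>\<^bsub>?L\<^esub> x = x"
      by (rule lim_mod_ext[of _ J])
        (use x in \<open>simp_all add: lim_mod_apply mem abelian_monoid.l_zero[OF m]\<close>)
  qed (use mem neg in auto)
  have "module K ?L"
  proof (rule moduleI)
    fix a b x assume a: "a \<in> carrier K" and b: "b \<in> carrier K" and x: "x \<in> carrier ?L"
    show "(a \<oplus>\<^bsub>K\<^esub> b) \<odot>\<^bsub>?L\<^esub> x = a \<odot>\<^bsub>?L\<^esub> x \<oplus>\<^bsub>?L\<^esub> b \<odot>\<^bsub>?L\<^esub> x"
      by (rule lim_mod_ext[of _ J])
        (use a b x in \<open>simp_all add: lim_mod_apply mem module.smult_l_distr[OF module_obj]\<close>)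
    show "(a \<otimes>\<^bsub>K\<^esub> b) \<odot>\<^bsub>?L\<^esub> x = a \<odot>\<^bsub>?L\<^esub> (b \<odot>\<^bsub>?L\<^esub> x)"
      by (rule lim_mod_ext[of _ J])
        (use a b x in \<open>simp_all add: lim_mod_apply mem module.smult_assoc1[OF module_obj]\<close>)
  next
    fix a x y assume a: "a \<in> carrier K" and x: "x \<in> carrier ?L" and y: "y \<in> carrier ?L"
    show "a \<odot>\<^bsub>?L\<^esub> (x \<oplus>\<^bsub>?L\<^esub> y) = a \<odot>\<^bsub>?L\<^esub> x \<oplus>\<^bsub>?L\<^esub> a \<odot>\<^bsub>?L\<^esub> y"
      by (rule lim_mod_ext[of _ J])
        (use a x y in \<open>simp_all add: lim_mod_apply mem module.smult_r_distr[OF module_obj]\<close>)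
  next
    fix x assume x: "x \<in> carrier ?L"
    show "\<one>\<^bsub>K\<^esub> \<odot>\<^bsub>?L\<^esub> x = x"
      by (rule lim_mod_ext[of _ J])
        (use x in \<open>simp_all add: lim_mod_apply mem module.smult_one[OF module_obj]\<close>)
  qed (use ag mem K.is_cring in auto)
  then show ?thesis by (simp add: vectorspace_def field_K)
qed

lemma linear_leg:
  assumes "j \<in> J"
  shows "linear_map K (lim_mod M J) (obj M j) (leg j)"
  using assms vectorspace_lim_mod vectorspace_obj
  by (auto simp: linear_map_def mod_hom_def mod_hom_axioms_def module_hom_def leg_def
      lim_mod_apply lim_mod_in vectorspace_def)

lemma leg_compatible:
  assumes "x \<in> carrier (lim_mod M J)" "i \<in> J" "j \<in> J" "i \<le> j"
  shows "str M i j (leg i x) = leg j x"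
  using assms by (simp add: lim_mod_simps leg_def)

lemma lim_mod_universal:
  fixes V :: "('k, 'w, 'c) module_scheme"
  assumes V: "vectorspace K V"
    and \<psi>: "\<And>j. j \<in> J \<Longrightarrow> linear_map K V (obj M j) (\<psi> j)"
    and cone: "\<And>i j v. i \<in> J \<Longrightarrow> j \<in> J \<Longrightarrow> i \<le> j \<Longrightarrow> v \<in> carrier V \<Longrightarrow> str M i j (\<psi> i v) = \<psi> j v"
  shows "\<exists>u. linear_map K V (lim_mod M J) u \<and> (\<forall>j\<in>J. \<forall>v\<in>carrier V. leg j (u v) = \<psi> j v)"
    and "\<And>u u' v. linear_map K V (lim_mod M J) u \<Longrightarrow> linear_map K V (lim_mod M J) u' \<Longrightarrow>
      (\<And>j v. j \<in> J \<Longrightarrow> v \<in> carrier V \<Longrightarrow> leg j (u v) = \<psi> j v) \<Longrightarrow>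
      (\<And>j v. j \<in> J \<Longrightarrow> v \<in> carrier V \<Longrightarrow> leg j (u' v) = \<psi> j v) \<Longrightarrow>
      v \<in> carrier V \<Longrightarrow> u v = u' v"
proof -
  have hom: "\<psi> j \<in> module_hom K V (obj M j)" if "j \<in> J" for j
    using \<psi>[OF that] by (simp add: linear_map_def mod_hom_def mod_hom_axioms_def)
  then have "(\<lambda>v. \<lambda>j\<in>J. \<psi> j v) \<in> module_hom K V (lim_mod M J)"
    using cone by (fastforce simp: module_hom_def lim_mod_simps restrict_def fun_eq_iff)
  then have "linear_map K V (lim_mod M J) (\<lambda>v. \<lambda>j\<in>J. \<psi> j v)"
    using V vectorspace_lim_mod[of J]
    by (auto simp: linear_map_def mod_hom_def mod_hom_axioms_def vectorspace_def)
  then show "\<exists>u. linear_map K V (lim_mod M J) u \<and> (\<forall>j\<in>J. \<forall>v\<in>carrier V. leg j (u v) = \<psi> j v)"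
    by (intro exI[of _ "\<lambda>v. \<lambda>j\<in>J. \<psi> j v"]) (simp add: leg_def)
next
  fix u u' v
  assume u: "linear_map K V (lim_mod M J) u" "linear_map K V (lim_mod M J) u'"
    and eq: "\<And>j v. j \<in> J \<Longrightarrow> v \<in> carrier V \<Longrightarrow> leg j (u v) = \<psi> j v"
      "\<And>j v. j \<in> J \<Longrightarrow> v \<in> carrier V \<Longrightarrow> leg j (u' v) = \<psi> j v"
    and v: "v \<in> carrier V"
  have "u v \<in> carrier (lim_mod M J)" "u' v \<in> carrier (lim_mod M J)"
    using u v by (auto simp: linear_map_def mod_hom_def mod_hom_axioms_def module_hom_def)
  then show "u v = u' v"
    by (rule lim_mod_ext) (use eq v in \<open>simp add: leg_def\<close>)
qed

end

end

theory Submission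
  imports Defs "HOL-Library.Dual_Ordered_Lattice"
begin

text \<open>
  The isomorphism from \<open>M\<close> to the chamber model sends \<open>v \<in> M p\<close> to the compatible family on the
  chamber of \<open>p\<close> whose value at \<open>p\<close> is \<open>v\<close>. Two facts make this work; once they are known, every
  identity between maps into a limit is checked by evaluating at one point of the chamber.

  The first fact is that this family exists and is unique, that is, that the legs of the limit cone
  are bijective (\<open>leg_iso\<close>). The structure maps inside a chamber are invertible, so a vector can be
  transported along every zigzag of the chamber. Uniqueness is connectedness; existence says that
  transport around a closed zigzag is trivial. The reason is \<open>flat_section_extend\<close>: for convex
  \<open>J\<close>, a family on the part of \<open>J\<close> lying over an interval of the first axis extends across one further
  comparable pair, by transporting horizontally and then vertically inside rectangles that convexity
  puts into \<open>J\<close>. Following a zigzag, the interval only grows, and an interval in a line cannot close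
  up to a loop. So a family defined along the zigzag has one value at each point
  (\<open>flat_section_exists\<close>).

  The second fact is that the map between the limits over two chambers \<open>J\<^sub>1\<close>, \<open>J\<^sub>2\<close> does not depend on
  the pair \<open>a \<le> b\<close> used to define it (\<open>transition_independent\<close>). It does not change when the pair is
  moved to a comparable pair, so it is enough that the comparable pairs in \<open>J\<^sub>1 \<times> J\<^sub>2\<close> form a connected
  set (\<open>order_connected_comparable_pairs\<close>). This is a planar fact. Two incomparable points of
  the plane lie left and right of each other, and both this relation and its converse are
  transitive. A point incomparable to all of \<open>J\<^sub>2\<close> therefore has all of \<open>J\<^sub>2\<close> on one side
  (\<open>one_side\<close>). A zigzag in \<open>J\<^sub>1\<close> that starts below \<open>J\<^sub>2\<close> can leave the region below \<open>J\<^sub>2\<close> only to the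
  left or to the right. It cannot get above \<open>J\<^sub>2\<close>, neither in one step (\<open>no_straddle\<close>) nor around an
  end of \<open>J\<^sub>2\<close> (\<open>hook_closes\<close>), and where it returns, it can be compared with the place where
  it left (\<open>below_one_of_two\<close>).
\<close>

section \<open>Zigzags and convex sets\<close>

definition comparable :: "'p::order \<Rightarrow> 'p \<Rightarrow> bool"
  where "comparable p q \<longleftrightarrow> p \<le> q \<or> q \<le> p"

abbreviation zigzag :: "'p::order set \<Rightarrow> 'p \<Rightarrow> 'p \<Rightarrow> bool"
  where "zigzag I \<equiv> (\<lambda>p q. p \<in> I \<and> q \<in> I \<and> comparable p q)\<^sup>*\<^sup>*"

lemma order_connected_iff_zigzag:
  "order_connected I \<longleftrightarrow> (\<forall>a\<in>I. \<forall>b\<in>I. zigzag I a b)"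
proof (intro iffI ballI)
  fix a b assume "order_connected I" and ab: "a \<in> I" "b \<in> I"
  then obtain n :: nat and x where x: "x 0 = a" "x n = b" "\<forall>i\<le>n. x i \<in> I"
      "\<forall>i<n. x i \<le> x (Suc i) \<or> x (Suc i) \<le> x i"
    unfolding order_connected_def by blast
  have "zigzag I a (x i)" if "i \<le> n" for i
    using that
  proof (induction i)
    case (Suc i)
    then have "x i \<in> I" "x (Suc i) \<in> I" "comparable (x i) (x (Suc i))"
      using x(3,4) by (auto simp: comparable_def)
    with Suc show ?case by (auto intro: rtranclp.rtrancl_into_rtrancl)
  qed (simp add: x)
  then show "zigzag I a b" using x(2) by blast
next
  assume *: "\<forall>a\<in>I. \<forall>b\<in>I. zigzag I a b"
  show "order_connected I"
    unfolding order_connected_def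
  proof (intro ballI)
    fix a b assume ab: "a \<in> I" "b \<in> I"
    with * have "zigzag I a b" by blast
    then obtain n where "((\<lambda>p q. p \<in> I \<and> q \<in> I \<and> comparable p q) ^^ n) a b"
      using rtranclp_imp_relpowp by meson
    then obtain x where x: "x 0 = a" "x n = b"
        "\<forall>i<n. x i \<in> I \<and> x (Suc i) \<in> I \<and> comparable (x i) (x (Suc i))"
      unfolding relpowp_fun_conv by blast
    have "x i \<in> I" if "i \<le> n" for i
      using that x ab by (cases "i = n") auto
    with x show "\<exists>(n::nat) x. x 0 = a \<and> x n = b \<and> (\<forall>i\<le>n. x i \<in> I) \<and>
        (\<forall>i<n. x i \<le> x (Suc i) \<or> x (Suc i) \<le> x i)"
      unfolding comparable_def by blast
  qed
qed

text \<open>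
  In this form connectedness is applied: a property that passes between comparable points of \<open>I\<close>
  holds on all of \<open>I\<close> or nowhere.
\<close>

lemma order_connected_induct [consumes 3, case_names base step]:
  assumes "order_connected I" "a \<in> I" "b \<in> I"
    and "Q a"
    and step: "\<And>p q. p \<in> I \<Longrightarrow> q \<in> I \<Longrightarrow> comparable p q \<Longrightarrow> Q p \<Longrightarrow> Q q"
  shows "Q b"
proof -
  have "zigzag I a b" using assms(1-3) by (simp add: order_connected_iff_zigzag)
  then show ?thesis by induction (use assms(4) step in blast)+
qed

lemma order_convexD: "order_convex I \<Longrightarrow> i \<in> I \<Longrightarrow> k \<in> I \<Longrightarrow> i \<le> j \<Longrightarrow> j \<le> k \<Longrightarrow> j \<in> I"
  unfolding order_convex_def by blast

lemma order_convex_Un: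
  fixes I B :: "'a::linorder set"
  assumes "order_convex I" "order_convex B" "y \<in> I" "y \<in> B"
  shows "order_convex (I \<union> B)"
  unfolding order_convex_def
proof (intro ballI allI impI, elim conjE)
  fix i k j assume "i \<in> I \<union> B" "k \<in> I \<union> B" "i \<le> j" "j \<le> k"
  then show "j \<in> I \<union> B"
    using assms(3,4) order_convexD[OF assms(1), of i y j] order_convexD[OF assms(1), of y k j]
      order_convexD[OF assms(2), of i y j] order_convexD[OF assms(2), of y k j] linear[of j y]
    by blast
qed

lemma order_convex_dual:
  assumes "order_convex J"
  shows "order_convex (dual ` J)"
  unfolding order_convex_def
proof (intro ballI allI impI, elim conjE)
  fix i k j assume "i \<in> dual ` J" "k \<in> dual ` J" "i \<le> j" "j \<le> k"
  then obtain i' k' where "i' \<in> J" "k' \<in> J" "undual j \<le> i'" "k' \<le> undual j"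
    by (auto simp: less_eq_dual_def)
  then have "undual j \<in> J" by (meson order_convexD[OF assms])
  then show "j \<in> dual ` J" by (rule rev_image_eqI) simp
qed

lemma order_connected_image:
  assumes "order_connected J" and mono: "\<And>p q. comparable p q \<Longrightarrow> comparable (f p) (f q)"
  shows "order_connected (f ` J)"
  unfolding order_connected_iff_zigzag
proof clarify
  fix a b assume "a \<in> J" "b \<in> J"
  with assms(1) show "zigzag (f ` J) (f a) (f b)"
  proof (induction rule: order_connected_induct)
    case (step p q)
    then show ?case by (auto intro: rtranclp.rtrancl_into_rtrancl mono)
  qed simp
qed

lemma order_connected_dual: "order_connected (dual ` J) \<longleftrightarrow> order_connected J"
  using order_connected_image[of J dual] order_connected_image[of "dual ` J" undual]
  by (auto simp: comparable_def less_eq_dual_def image_image)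

section \<open>Orders with a left-right relation\<close>

text \<open>
  For the comparison of two chambers, planarity enters only through a conjugate order: a strict order whose
  comparable pairs are exactly the incomparable pairs of \<open>\<le>\<close>. The axioms are symmetric under
  exchanging left and right and under reversing \<open>\<le>\<close>, so that each statement below is proved for one
  side, or one direction, only.
\<close>

locale planar_order =
  fixes left_of :: "'p::lattice \<Rightarrow> 'p \<Rightarrow> bool"
  assumes left_of_trans: "left_of p q \<Longrightarrow> left_of q r \<Longrightarrow> left_of p r"
    and left_of_incomparable: "left_of p q \<Longrightarrow> \<not> comparable p q"
    and incomparable_left_of: "\<not> comparable p q \<Longrightarrow> left_of p q \<or> left_of q p"
begin

lemma planar_order_mirror: "planar_order (\<lambda>p q. left_of q p)"
  by unfold_locales
    (use left_of_trans left_of_incomparable incomparable_left_of in \<open>auto simp: comparable_def\<close>)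

lemma planar_order_dual: "planar_order (\<lambda>p q. left_of (undual p) (undual q))"
  by unfold_locales
    (use left_of_trans left_of_incomparable incomparable_left_of in
      \<open>auto simp: comparable_def less_eq_dual_def\<close>)

text \<open>
  If \<open>sup u p\<close> were left of \<open>sup v p\<close>, then it would also be left of \<open>v\<close>, which lies below the second
  join but is incomparable to the first. As \<open>v\<close> is left of \<open>p\<close>, this would put \<open>sup u p\<close> left of \<open>p\<close>,
  although it is above \<open>p\<close>.
\<close>

lemma joins_on_one_side_comparable:
  assumes "left_of u p" "left_of v p"
  shows "comparable (sup u p) (sup v p)"
proof (rule ccontr)
  have *: "\<not> left_of (sup u p) (sup v p)" if "left_of u p" "left_of v p" for u v
  proof
    assume l: "left_of (sup u p) (sup v p)"
    have "\<not> comparable v (sup u p)"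
      using l that left_of_incomparable unfolding comparable_def
      by (meson le_sup_iff order_trans sup.cobounded2)
    with l that show False
      using left_of_trans left_of_incomparable incomparable_left_of unfolding comparable_def
      by (meson sup.cobounded1 sup.cobounded2)
  qed
  assume "\<not> comparable (sup u p) (sup v p)"
  with * assms show False using incomparable_left_of by blast
qed

text \<open>
  Two comparable points cannot lie on different sides of \<open>w\<close>, since they would then be left and
  right of each other.
\<close>

lemma one_side:
  assumes "order_connected J" and inc: "\<And>c. c \<in> J \<Longrightarrow> \<not> comparable w c"
  shows "(\<forall>c\<in>J. left_of w c) \<or> (\<forall>c\<in>J. left_of c w)"
proof -
  have "left_of w c'" if "c \<in> J" "c' \<in> J" "left_of w c" for c c'
    using assms(1) that
  proof (induction rule: order_connected_induct)
    case (step p q)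
    then show ?case
      using inc[of q] left_of_trans left_of_incomparable incomparable_left_of
      unfolding comparable_def by blast
  qed
  then show ?thesis using inc incomparable_left_of by blast
qed

text \<open>
  A zigzag of \<open>J\<close> between two points above \<open>p\<close> may leave \<open>{p..}\<close>. As \<open>p \<notin> J\<close>, convexity keeps it out of
  \<open>{..p}\<close>, so that it leaves on one side of \<open>p\<close> and comes back on the same side. The joins with \<open>p\<close> of
  the last point before and the first point after the excursion lie in \<open>J\<close> and are comparable; they
  close the gap.
\<close>

lemma order_connected_Int_atLeast:
  fixes p :: 'p
  assumes conv: "order_convex J" and conn: "order_connected J" and p: "p \<notin> J"
  shows "order_connected (J \<inter> {p..})"
  unfolding order_connected_iff_zigzag
proof (intro ballI)
  fix b b' :: 'p assume b: "b \<in> J \<inter> {p..}" and b': "b' \<in> J \<inter> {p..}"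
  let ?R = "zigzag (J \<inter> {p..}) b"
  let ?same_side = "\<lambda>u w. left_of u p \<and> left_of w p \<or> left_of p u \<and> left_of p w"
  have R_step: "?R y" if "?R x" "x \<in> J" "p \<le> x" "y \<in> J" "p \<le> y" "comparable x y" for x y
    using that by (auto intro: rtranclp.rtrancl_into_rtrancl)
  have R_in: "x \<in> J" "p \<le> x" if "?R x" for x
    using that b by (cases; auto)+
  have not_le: "\<not> w \<le> p" if "w \<in> J" for w
    using that b p conv order_convexD[of J w b p] by auto
  have joins: "comparable (sup u p) (sup w p)" if "?same_side u w" for u w
    using that joins_on_one_side_comparable
      planar_order.joins_on_one_side_comparable[OF planar_order_mirror] by blast
  have "b \<in> J" "b' \<in> J" using b b' by auto
  \<comment> \<open>Outside \<open>{p..}\<close> the invariant remembers a join \<open>sup u p\<close> on the boundary that was reached on the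
    side of \<open>p\<close> on which the zigzag still is.\<close>
  with conn have "if p \<le> b' then ?R b' else \<exists>u. ?same_side u b' \<and> ?R (sup u p)"
  proof (induction rule: order_connected_induct)
    case base
    then show ?case using b by simp
  next
    case (step w w')
    consider "p \<le> w" "p \<le> w'" | "p \<le> w" "\<not> p \<le> w'" | "\<not> p \<le> w" "p \<le> w'" | "\<not> p \<le> w" "\<not> p \<le> w'"
      by blast
    then show ?case
    proof cases
      case 1
      with step R_step[of w w'] show ?thesis by simp
    next
      case 2
      then have le: "w' \<le> w" using step(3) unfolding comparable_def by (meson order_trans)
      then have "sup w' p \<in> J" using conv step(1,2) 2 by (meson order_convexD le_sup_iff sup_ge1)
      then have "?R (sup w' p)"
        using R_step[of w "sup w' p"] step 2 le by (simp add: comparable_def)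
      moreover have "?same_side w' w'"
        using incomparable_left_of[of w' p] not_le[OF step(2)] 2 by (auto simp: comparable_def)
      ultimately show ?thesis using 2 by auto
    next
      case 3
      then have le: "w \<le> w'" using step(3) unfolding comparable_def by (meson order_trans)
      then have in_J: "sup w p \<in> J" using conv step(1,2) 3 by (meson order_convexD le_sup_iff sup_ge1)
      obtain u where u: "?same_side u w" "?R (sup u p)" using step(4) 3 by auto
      have "?R (sup w p)"
        using R_step[OF u(2) R_in[OF u(2)] in_J _ joins[OF u(1)]] by simp
      then show ?thesis
        using R_step[of "sup w p" w'] in_J step 3 le by (simp add: comparable_def)
    next
      case 4
      then have "\<not> comparable w p" "\<not> comparable w' p"
        using not_le step(1,2) by (auto simp: comparable_def)
      then have "?same_side w w'"
        using step(3) left_of_trans left_of_incomparable incomparable_left_of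
        unfolding comparable_def by blast
      moreover have "\<not> (left_of p w \<and> left_of w p)"
        using left_of_trans left_of_incomparable unfolding comparable_def by blast
      ultimately show ?thesis using step(4) 4 by auto
    qed
  qed
  then show "?R b'" using b' by simp
qed

lemma order_connected_Int_atMost:
  fixes p :: 'p
  assumes "order_convex J" "order_connected J" "p \<notin> J"
  shows "order_connected (J \<inter> {..p})"
proof -
  interpret d: planar_order "\<lambda>p q. left_of (undual p) (undual q)" by (rule planar_order_dual)
  have "order_connected (dual ` J \<inter> {dual p..})"
    using assms by (intro d.order_connected_Int_atLeast order_convex_dual)
      (auto simp: order_connected_dual)
  moreover have "dual ` J \<inter> {dual p..} = dual ` (J \<inter> {..p})" by auto
  ultimately show ?thesis by (simp add: order_connected_dual)
qed

section \<open>Comparable pairs between disjoint convex sets\<close>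

text \<open>
  The two intervals \<open>{p..p'}\<close> and \<open>{q'..q}\<close> share the point \<open>sup p q'\<close>.
\<close>

lemma crossing_intervals_meet:
  fixes p p' q q' :: 'p
  assumes "order_convex J1" "order_convex J2"
    and "p \<in> J1" "p' \<in> J1" "q \<in> J2" "q' \<in> J2" "p \<le> p'" "q' \<le> q" "p \<le> q" "q' \<le> p'"
  shows "J1 \<inter> J2 \<noteq> {}"
proof -
  have "sup p q' \<in> J1"
    by (rule order_convexD[of J1 p p']) (rule assms sup_ge1 sup_least)+
  moreover have "sup p q' \<in> J2"
    by (rule order_convexD[of J2 q' q]) (rule assms sup_ge2 sup_least)+
  ultimately show ?thesis by blast
qed

text \<open>
  The set \<open>{..p} \<union> {p..p'} \<union> {p'..}\<close> separates its complement into a left and a right part. \<open>J2\<close> avoids it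
  and is connected, so it stays on the side where \<open>q\<close> is. But then \<open>q'\<close> is on this side, too, which
  makes \<open>q' \<le> q\<close>, and the intervals \<open>{q'..q}\<close> and \<open>{p..p'}\<close> cross.
\<close>

lemma no_straddle:
  fixes p p' q q' :: 'p
  assumes conv: "order_convex J1" "order_convex J2" and conn: "order_connected J2"
    and disj: "J1 \<inter> J2 = {}"
    and p: "p \<in> J1" "p' \<in> J1" "p \<le> p'"
    and q: "q \<in> J2" "q' \<in> J2" "p \<le> q" "q' \<le> p'"
  shows False
proof -
  have *: False if l: "left q p'" and pl: "planar_order left" for left
  proof -
    interpret l: planar_order left by (rule pl)
    note l_simps = l.left_of_trans l.left_of_incomparable[unfolded comparable_def]
      l.incomparable_left_of[unfolded comparable_def]
    \<comment> \<open>To be left of the separating set is to be left of \<open>p'\<close> or left of \<open>p\<close>.\<close>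
    have "left q' p' \<or> left q' p"
      using conn q(1,2)
    proof (induction rule: order_connected_induct)
      case base
      then show ?case using l by simp
    next
      case (step r s)
      have meet: False if "s' \<in> J2" "s'' \<in> J2" "s' \<le> s''" "s' \<le> p'" "p \<le> s''" for s' s''
        using crossing_intervals_meet[OF conv, of p p' s'' s'] that p disj by blast
      have s: "\<not> s \<le> p" "\<not> p' \<le> s" "\<not> (p \<le> s \<and> s \<le> p')"
        using meet[of s q] meet[of q' s] meet[of s s] step(2) q p by (meson order_trans order_refl)+
      show ?case
      proof (rule ccontr)
        assume n: "\<not> (left s p' \<or> left s p)"
        have s1: "s \<le> p' \<or> left p' s" and s2: "p \<le> s \<or> left p s"
          using n s l_simps by blast+
        have rs: "r \<le> s \<or> s \<le> r" using step(3) by (simp add: comparable_def)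
        consider "left r p'" | "left r p" using step(4) by blast
        then show False
        proof cases
          case 1
          have a: "\<not> left p' s" using 1 rs l_simps by blast
          then have b: "s \<le> p'" "left p s" using s s1 s2 by blast+
          then have "s \<le> r" using 1 rs l_simps by (meson order_trans)
          moreover have "p \<le> r" using 1 b l_simps rs p
            by (metis order_trans)
          ultimately show False using meet[of s r] b step by blast
        next
          case 2
          have a: "\<not> left p s" using 2 rs l_simps by blast
          then have b: "p \<le> s" "left p' s" using s s1 s2 by blast+
          then have "r \<le> s" using 2 rs l_simps by (meson order_trans)
          moreover have "r \<le> p'" using 2 b l_simps rs p
            by (metis order_trans)
          ultimately show False using meet[of r s] b step by blast
        qed
      qed
    qed
    then have "left q' p" using q(4) l_simps by blast
    then have "q' \<le> q"
      using l l_simps q p by (metis order_trans)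
    then show False using crossing_intervals_meet[OF conv p(1,2) q(1,2) p(3)] q disj by blast
  qed
  have "\<not> q \<le> p'" "\<not> p' \<le> q"
    using conv p q disj unfolding order_convex_def by blast+
  then have "left_of q p' \<or> left_of p' q" using incomparable_left_of by (simp add: comparable_def)
  then show False using *[of left_of] *[of "\<lambda>p q. left_of q p"] planar_order_mirror planar_order_axioms
    by blast
qed

text \<open>
  Otherwise \<open>u\<close> is left of \<open>c'\<close> and \<open>u'\<close> is left of \<open>c\<close>. Each of the four possible relations between
  \<open>u\<close> and \<open>u'\<close> contradicts this; for instance, \<open>u\<close> left of \<open>u'\<close> puts \<open>u\<close> left of \<open>c\<close>.
\<close>

lemma below_one_of_two:
  assumes "u \<le> w" "u' \<le> w'" "u \<le> c" "u' \<le> c'"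
    and "left_of w c" "left_of w c'" "left_of w' c" "left_of w' c'"
  shows "u \<le> c' \<or> u' \<le> c"
proof (rule ccontr)
  have cross: "left_of u c'" if "\<not> u \<le> c'" "u \<le> w" "left_of w c'" for u w c'
  proof -
    have "\<not> c' \<le> u"
      using that left_of_incomparable[of w c'] unfolding comparable_def by (meson order_trans)
    moreover have "\<not> left_of c' u"
      using that left_of_trans[of w c' u] left_of_incomparable[of w u] unfolding comparable_def by blast
    ultimately show ?thesis
      using that incomparable_left_of[of u c'] unfolding comparable_def by blast
  qed
  assume "\<not> (u \<le> c' \<or> u' \<le> c)"
  then have l: "left_of u c'" "left_of u' c" and n: "\<not> u \<le> c'" "\<not> u' \<le> c"
    using cross assms by blast+
  have "\<not> u \<le> u'" "\<not> u' \<le> u" using n assms by (meson order_trans)+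
  moreover have "\<not> left_of u u'" "\<not> left_of u' u"
    using l assms(3,4) left_of_trans left_of_incomparable unfolding comparable_def by blast+
  ultimately show False using incomparable_left_of unfolding comparable_def by blast
qed

text \<open>
  A zigzag that passes from below \<open>b\<close> around the left end of a set containing \<open>b\<close> and \<open>q\<close> to a point
  \<open>z\<close> above \<open>q\<close> has \<open>u \<le> z\<close>. Together with \<open>no_straddle\<close> this excludes such zigzags in a convex
  set disjoint from the one they go around.
\<close>

lemma hook_closes:
  assumes "u \<le> w" "l \<le> z" "u \<le> b" "q \<le> z"
    and "left_of w b" "left_of w q" "left_of l b" "left_of l q"
  shows "u \<le> z"
proof (rule ccontr)
  assume n: "\<not> u \<le> z"
  note inc = left_of_incomparable[unfolded comparable_def]
  note tot = incomparable_left_of[unfolded comparable_def]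
  have "\<not> z \<le> u" using assms inc[of w q] by (meson order_trans)
  with n have uz: "left_of u z \<or> left_of z u" using tot by blast
  have "\<not> u \<le> q" "\<not> q \<le> u" using n assms inc[of w q] by (meson order_trans)+
  moreover have "\<not> left_of q u" using assms inc[of w u] left_of_trans[of w q u] by blast
  ultimately have uq: "left_of u q" using tot by blast
  have "\<not> left_of z u" using left_of_trans[OF _ uq, of z] inc[of z q] assms by blast
  with uz have uz: "left_of u z" by blast
  have "\<not> u \<le> l" "\<not> l \<le> u" using n assms inc[of l b] by (meson order_trans)+
  moreover have "\<not> left_of l u" using left_of_trans[OF _ uz, of l] inc[of l z] assms by blast
  moreover have "\<not> left_of u l" using left_of_trans[of u l b] inc[of u b] assms by blast
  ultimately show False using tot by blast
qed

text \<open>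
  Moving only \<open>b\<close>, or only \<open>a\<close>, is possible by \<open>order_connected_Int_atLeast\<close> and
  \<open>order_connected_Int_atMost\<close>. So a zigzag in \<open>J1\<close> from \<open>a0\<close> to \<open>a\<close> can be followed as long as it
  stays below \<open>J2\<close>. During an excursion all its points lie beside \<open>J2\<close>, on a fixed side, because
  \<open>hook_closes\<close> and \<open>no_straddle\<close> keep it from getting above \<open>J2\<close>. By \<open>below_one_of_two\<close> the pair at the
  return is connected to the pair at the exit.
\<close>

lemma order_connected_comparable_pairs:
  fixes J1 J2 :: "'p set"
  assumes conv: "order_convex J1" "order_convex J2"
    and conn: "order_connected J1" "order_connected J2"
    and disj: "J1 \<inter> J2 = {}"
  shows "order_connected {(a, b). a \<in> J1 \<and> b \<in> J2 \<and> a \<le> b}" (is "order_connected ?E")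
  unfolding order_connected_iff_zigzag
proof clarify
  fix a0 b0 a b assume 0: "a0 \<in> J1" "b0 \<in> J2" "a0 \<le> b0" and ab: "a \<in> J1" "b \<in> J2" "a \<le> b"
  define R where "R x y = zigzag ?E (a0, b0) (x, y)" for x y
  have R_step: "R x' y'" if "R x y" "(x, y) \<in> ?E" "(x', y') \<in> ?E" "comparable (x, y) (x', y')"
    for x y x' y'
    using that unfolding R_def by (auto intro: rtranclp.rtrancl_into_rtrancl)
  have R_up: "R x y'" if "R x y" "x \<in> J1" "y \<in> J2" "y' \<in> J2" "x \<le> y" "x \<le> y'" for x y y'
  proof -
    have "order_connected (J2 \<inter> {x..})"
      using order_connected_Int_atLeast conv conn disj that by blast
    moreover have "y \<in> J2 \<inter> {x..}" "y' \<in> J2 \<inter> {x..}" using that by auto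
    ultimately show ?thesis
    proof (induction rule: order_connected_induct)
      case (step p q)
      then show ?case using R_step[of x p x q] that by (auto simp: comparable_def)
    qed (use that in simp)
  qed
  have R_down: "R x' y" if "R x y" "x \<in> J1" "x' \<in> J1" "y \<in> J2" "x \<le> y" "x' \<le> y" for x x' y
  proof -
    have "order_connected (J1 \<inter> {..y})"
      using order_connected_Int_atMost conv conn disj that by blast
    moreover have "x \<in> J1 \<inter> {..y}" "x' \<in> J1 \<inter> {..y}" using that by auto
    ultimately show ?thesis
    proof (induction rule: order_connected_induct)
      case (step p q)
      then show ?case using R_step[of p y q y] that by (auto simp: comparable_def)
    qed (use that in simp)
  qed
  define beside where "beside v w \<longleftrightarrow>
    (\<forall>c\<in>J2. left_of v c \<and> left_of w c) \<or> (\<forall>c\<in>J2. left_of c v \<and> left_of c w)" for v w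
  have beside_self: "beside w w" if "w \<in> J1" "\<forall>c\<in>J2. \<not> comparable w c" for w
    using one_side[OF conn(2), of w] that unfolding beside_def by blast
  have beside_inc: "\<not> comparable w c" if "beside v w" "c \<in> J2" for v w c
    using that left_of_incomparable[of w c] left_of_incomparable[of c w]
    unfolding beside_def comparable_def by blast
  have straddle: False if "p \<in> J1" "p' \<in> J1" "p \<le> p'" "q \<in> J2" "q' \<in> J2" "p \<le> q" "q' \<le> p'"
    for p p' q q'
    using no_straddle[OF conv conn(2) disj that] .
  have one_of_two: "u \<le> c' \<or> u' \<le> c"
    if "beside v w" "u \<le> v" "u' \<le> w" "u \<le> c" "u' \<le> c'" "c \<in> J2" "c' \<in> J2" for u u' v w c c'
    using that below_one_of_two[of u v u' w c c']
      planar_order.below_one_of_two[OF planar_order_mirror, of u v u' w c c']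
    unfolding beside_def by blast
  have hook: "u \<le> z"
    if "beside v w" "u \<le> v" "w \<le> z" "u \<le> c" "q \<le> z" "c \<in> J2" "q \<in> J2" for u v w z c q
    using that hook_closes[of u v w z c q]
      planar_order.hook_closes[OF planar_order_mirror, of u v w z c q]
    unfolding beside_def by blast
  \<comment> \<open>During an excursion, \<open>u\<close> is the last point below \<open>J2\<close> and \<open>v\<close> is the next point, which is already
    beside \<open>J2\<close>.\<close>
  define Q where "Q w \<longleftrightarrow> (if \<exists>c\<in>J2. w \<le> c then \<forall>c\<in>J2. w \<le> c \<longrightarrow> R w c
    else \<exists>u\<in>J1. \<exists>v\<in>J1. \<exists>c\<in>J2. u \<le> v \<and> beside v w \<and> u \<le> c \<and> R u c)" for w
  have Q_I: "Q w" if "w \<in> J1" "w \<le> c" "c \<in> J2" "R w c" for w c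
    using that R_up[of w c] unfolding Q_def by auto
  have "R a0 b0" unfolding R_def by simp
  then have Q0: "Q a0" using Q_I 0 by blast
  from conn(1) 0(1) ab(1) have "Q a"
  proof (induction rule: order_connected_induct)
    case base
    show ?case by (rule Q0)
  next
    case (step w w')
    show ?case
    proof (cases "\<exists>c\<in>J2. w \<le> c")
      case w: True
      then obtain c where c: "c \<in> J2" "w \<le> c" "R w c" using step(4) unfolding Q_def by auto
      show ?thesis
      proof (cases "\<exists>c'\<in>J2. w' \<le> c'")
        case True
        then obtain c' where c': "c' \<in> J2" "w' \<le> c'" by blast
        from step(3) consider "w \<le> w'" | "w' \<le> w" unfolding comparable_def by blast
        then show ?thesis
        proof cases
          case 1
          then have le: "w \<le> c'" using c' by order
          then have "R w c'" using R_up c c' step(1) by blast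
          then have "R w' c'" using R_down step(1,2) c' le by blast
          then show ?thesis using Q_I step(2) c' by blast
        next
          case 2
          then have "w' \<le> c" using c by order
          then show ?thesis using Q_I R_down step(1,2) c by blast
        qed
      next
        case w': False
        then have le: "w \<le> w'" using step(3) c unfolding comparable_def by (meson order_trans)
        then have "beside w' w'"
          using beside_self step(1,2) straddle[of w w'] c w' unfolding comparable_def by blast
        then show ?thesis using w' le c step(1,2) unfolding Q_def by auto
      qed
    next
      case w: False
      then obtain u v c where u: "u \<in> J1" "v \<in> J1" "c \<in> J2" "u \<le> v" "beside v w" "u \<le> c" "R u c"
        using step(4) unfolding Q_def by auto
      show ?thesis
      proof (cases "\<exists>c'\<in>J2. w' \<le> c'")
        case True
        then obtain c' where c': "c' \<in> J2" "w' \<le> c'" by blast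
        then have "w' \<le> w" using step(3) w unfolding comparable_def by (meson order_trans)
        then consider "u \<le> c'" | "w' \<le> c" using one_of_two[of v w u w' c c'] u c' by blast
        then show ?thesis
        proof cases
          case 1
          then have "R u c'" using R_up u c' by blast
          then have "R w' c'" using R_down u c' 1 step(2) by blast
          then show ?thesis using Q_I step(2) c' by blast
        next
          case 2
          then show ?thesis using Q_I R_down step(2) u by blast
        qed
      next
        case w': False
        have not_above: "\<not> q \<le> w'" if q: "q \<in> J2" for q
        proof
          assume qw': "q \<le> w'"
          have "\<not> w' \<le> w" using beside_inc[OF u(5) q] qw' unfolding comparable_def by (meson order_trans)
          then have "w \<le> w'" using step(3) unfolding comparable_def by blast
          then have "u \<le> w'" using hook[of v w u w' c q] u q qw' by blast
          then show False using straddle[of u w' c q] u step(2) q qw' by blast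
        qed
        then have b: "beside w' w'" using beside_self step(2) w' unfolding comparable_def by blast
        have "beside v w'"
          using u(3,5) b step(3) left_of_trans left_of_incomparable unfolding beside_def comparable_def by blast
        then show ?thesis using w' u unfolding Q_def by auto
      qed
    qed
  qed
  then have "R a b" using ab unfolding Q_def by metis
  then show "zigzag ?E (a0, b0) (a, b)" by (simp only: R_def)
qed

end

interpretation coordinate_plane:
  planar_order "\<lambda>p q :: 'a::{linorder,lattice} \<times> 'b::{linorder,lattice}. fst p < fst q \<and> snd q < snd p"
  by unfold_locales (auto simp: comparable_def less_eq_prod_def)

section \<open>Transport inside a convex set\<close>

text \<open>
  Fibres that are identified along all comparable pairs, in both directions. The cocycle condition
  is required only for pairwise comparable triples, and it implies that \<open>\<tau> q p\<close> inverts \<open>\<tau> p q\<close>.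
\<close>

locale local_system =
  fixes J :: "'p::order set" and F :: "'p \<Rightarrow> 'v set" and \<tau> :: "'p \<Rightarrow> 'p \<Rightarrow> 'v \<Rightarrow> 'v"
  assumes transport_in: "p \<in> J \<Longrightarrow> q \<in> J \<Longrightarrow> comparable p q \<Longrightarrow> x \<in> F p \<Longrightarrow> \<tau> p q x \<in> F q"
    and transport_id: "p \<in> J \<Longrightarrow> x \<in> F p \<Longrightarrow> \<tau> p p x = x"
    and transport_comp: "p \<in> J \<Longrightarrow> q \<in> J \<Longrightarrow> r \<in> J \<Longrightarrow>
      comparable p q \<Longrightarrow> comparable q r \<Longrightarrow> comparable p r \<Longrightarrow> x \<in> F p \<Longrightarrow> \<tau> q r (\<tau> p q x) = \<tau> p r x"
begin

definition flat_section :: "'p set \<Rightarrow> ('p \<Rightarrow> 'v) \<Rightarrow> bool"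
  where "flat_section Y f \<longleftrightarrow> (\<forall>p\<in>Y. f p \<in> F p) \<and>
    (\<forall>p\<in>Y. \<forall>q\<in>Y. comparable p q \<longrightarrow> \<tau> p q (f p) = f q)"

lemma transport_sym:
  assumes "p \<in> J" "q \<in> J" "comparable p q" "x \<in> F p" "\<tau> p q x = y"
  shows "\<tau> q p y = x"
  using assms transport_comp[of p q p x] transport_id[of p x] by (auto simp: comparable_def)

end

locale plane_local_system = local_system J F \<tau>
  for J :: "('a::linorder \<times> 'b::linorder) set" and F :: "'a \<times> 'b \<Rightarrow> 'v set" and \<tau> +
  assumes convex: "order_convex J"
begin

abbreviation strip :: "'a set \<Rightarrow> ('a \<times> 'b) set"
  where "strip I \<equiv> {p \<in> J. fst p \<in> I}"

lemma corner_in: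
  assumes "p \<in> J" "q \<in> J" "comparable p q" "min (fst p) (fst q) \<le> x" "x \<le> max (fst p) (fst q)"
  shows "(x, snd p) \<in> J" "comparable p (x, snd p)" "comparable (x, snd p) q"
proof -
  have "p \<le> (x, snd p) \<and> (x, snd p) \<le> q \<or> q \<le> (x, snd p) \<and> (x, snd p) \<le> p"
    using assms(3-) by (auto simp: comparable_def less_eq_prod_def min_def max_def split: if_splits)
  then show "(x, snd p) \<in> J" "comparable p (x, snd p)" "comparable (x, snd p) q"
    using assms(1,2) order_convexD[OF convex] unfolding comparable_def by blast+
qed

text \<open>
  Between the vertical lines through \<open>y\<close> and \<open>z\<close> every point \<open>p\<close> is reached from \<open>y\<close> by a horizontal step
  inside the rectangle spanned by \<open>y\<close> and \<open>z\<close>, followed by a vertical step. For \<open>p \<le> q\<close>, both of these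
  paths continue to a point \<open>t\<close> above \<open>p\<close>, \<open>q\<close> and the two corners, where they agree.
\<close>

lemma flat_section_between:
  assumes y: "y \<in> J" and z: "z \<in> J" and yz: "comparable y z" and v: "v \<in> F y"
  defines "B \<equiv> {min (fst y) (fst z)..max (fst y) (fst z)}"
  defines "g \<equiv> \<lambda>p. \<tau> (fst p, snd y) p (\<tau> y (fst p, snd y) v)"
  shows "flat_section (strip B) g"
proof -
  let ?e = "\<lambda>p :: 'a \<times> 'b. (fst p, snd y)"
  have e: "?e p \<in> J" "comparable y (?e p)" "comparable (?e p) p" if "p \<in> strip B" for p
    using corner_in(1,2)[OF y z yz, of "fst p"] that unfolding B_def
    by (auto simp: comparable_def less_eq_prod_def)
  have ev: "\<tau> y (?e p) v \<in> F (?e p)" if "p \<in> strip B" for p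
    using transport_in[OF y e(1,2)[OF that] v] .
  have gF: "g p \<in> F p" if "p \<in> strip B" for p
    using transport_in[OF e(1)[OF that] _ e(3)[OF that] ev[OF that]] that unfolding g_def by simp
  have mono: "\<tau> p q (g p) = g q" if p: "p \<in> strip B" and q: "q \<in> strip B" and pq: "p \<le> q" for p q
  proof -
    \<comment> \<open>\<open>t\<close> is the higher one of \<open>q\<close> and its corner \<open>?e q\<close>, hence in \<open>J\<close>.\<close>
    define t where "t = (fst q, max (snd q) (snd y))"
    have t: "t \<in> J" using q e(1)[OF q] unfolding t_def by (auto simp: max_def)
    have pJ: "p \<in> J" "q \<in> J" using p q by auto
    have le: "p \<le> t" "q \<le> t" "?e p \<le> t" "?e q \<le> t" "?e p \<le> ?e q"
      using pq unfolding t_def by (auto simp: less_eq_prod_def le_max_iff_disj)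
    then have c: "comparable p t" "comparable q t" "comparable (?e p) t" "comparable (?e q) t"
        "comparable (?e p) (?e q)" "comparable p q" "comparable t q" using pq by (auto simp: comparable_def)
    have "\<tau> p t (g p) = \<tau> (?e p) t (\<tau> y (?e p) v)"
      unfolding g_def by (rule transport_comp) (use p pJ t e[OF p] c ev in auto)
    also have "\<dots> = \<tau> (?e q) t (\<tau> (?e p) (?e q) (\<tau> y (?e p) v))"
      by (rule transport_comp[symmetric]) (use p q t e c ev in auto)
    also have "\<tau> (?e p) (?e q) (\<tau> y (?e p) v) = \<tau> y (?e q) v"
      by (rule transport_comp) (use p q y v e c in auto)
    also have "\<tau> (?e q) t (\<tau> y (?e q) v) = \<tau> q t (g q)"
      unfolding g_def by (rule transport_comp[symmetric]) (use q pJ t e[OF q] c ev in auto)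
    finally have eq: "\<tau> p t (g p) = \<tau> q t (g q)" .
    have "\<tau> p q (g p) = \<tau> t q (\<tau> p t (g p))"
      by (rule transport_comp[symmetric]) (use pJ t c gF[OF p] in auto)
    also have "\<dots> = g q"
      unfolding eq using transport_sym[OF pJ(2) t c(2) gF[OF q] refl] .
    finally show ?thesis .
  qed
  have "\<tau> p q (g p) = g q" if "p \<in> strip B" "q \<in> strip B" "comparable p q" for p q
    using that mono[of p q] mono[of q p] transport_sym[of q p "g q" "g p"] gF[of q]
    by (auto simp: comparable_def)
  then show ?thesis unfolding flat_section_def using gF by blast
qed

text \<open>
  The new part is the section of \<open>flat_section_between\<close> that starts with the value of \<open>f\<close> at \<open>y\<close>. It agrees
  with \<open>f\<close> where both are defined, since the steps used to define it stay in the strip. A comparable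
  pair whose first point lies only in the old part and whose second point lies only in the new part
  crosses the vertical line through \<open>y\<close>, where both parts are
  defined, so transport along it splits into two steps that are already understood.
\<close>

lemma flat_section_extend:
  assumes conv: "order_convex I" and f: "flat_section (strip I) f"
    and y: "y \<in> strip I" and z: "z \<in> J" and yz: "comparable y z"
  obtains I' f' where "order_convex I'" "flat_section (strip I') f'" "I \<subseteq> I'" "fst z \<in> I'"
    "\<And>p. p \<in> strip I \<Longrightarrow> f' p = f p"
proof -
  define B where "B = {min (fst y) (fst z)..max (fst y) (fst z)}"
  define g where "g = (\<lambda>p. \<tau> (fst p, snd y) p (\<tau> y (fst p, snd y) (f y)))"
  have fF: "f p \<in> F p" if "p \<in> strip I" for p
    using f that unfolding flat_section_def by blast
  have fD: "\<tau> p q (f p) = f q" if "p \<in> strip I" "q \<in> strip I" "comparable p q" for p q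
    using f that unfolding flat_section_def by blast
  have yJ: "y \<in> J" using y by simp
  have g: "flat_section (strip B) g"
    unfolding B_def g_def by (rule flat_section_between[OF yJ z yz fF[OF y]])
  have gF: "g p \<in> F p" if "p \<in> strip B" for p
    using g that unfolding flat_section_def by blast
  have gD: "\<tau> p q (g p) = g q" if "p \<in> strip B" "q \<in> strip B" "comparable p q" for p q
    using g that unfolding flat_section_def by blast
  have agree: "g p = f p" if p: "p \<in> strip I" "p \<in> strip B" for p
  proof -
    let ?e = "(fst p, snd y)"
    have e: "?e \<in> strip I" "comparable y ?e" "comparable ?e p"
      using corner_in(1,2)[OF yJ z yz, of "fst p"] p unfolding B_def
      by (auto simp: comparable_def less_eq_prod_def)
    show ?thesis
      unfolding g_def using fD[OF y e(1,2)] fD[OF e(1) p(1) e(3)] by simp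
  qed
  define f' where "f' p = (if fst p \<in> I then f p else g p)" for p
  have f'B: "f' p = g p" if "p \<in> strip B" for p
    using that agree unfolding f'_def by auto
  have f'F: "f' p \<in> F p" if "p \<in> strip (I \<union> B)" for p
    using that fF[of p] gF[of p] unfolding f'_def by auto
  have across: "\<tau> p q (f' p) = f' q"
    if p: "p \<in> strip I" and q: "q \<in> strip B" "fst q \<notin> I" and pq: "comparable p q" for p q
  proof (cases "fst p \<in> B")
    case True
    then show ?thesis using p q gD[of p q] pq f'B by auto
  next
    case False
    let ?s = "(fst y, snd p)"
    have "min (fst p) (fst q) \<le> fst y \<and> fst y \<le> max (fst p) (fst q)"
    proof -
      have "fst y \<in> I" "fst p \<in> I" using y p by auto
      then have "\<not> (fst y \<le> fst q \<and> fst q \<le> fst p)" "\<not> (fst p \<le> fst q \<and> fst q \<le> fst y)"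
        using q(2) order_convexD[OF conv] by blast+
      then show ?thesis using q(1) False unfolding B_def min_def max_def
        by (auto split: if_splits)
    qed
    then have s: "?s \<in> J" "comparable p ?s" "comparable ?s q"
      using corner_in[of p q "fst y"] p q pq by auto
    have sB: "?s \<in> strip B" "?s \<in> strip I" using s y unfolding B_def by auto
    have "\<tau> p q (f' p) = \<tau> ?s q (\<tau> p ?s (f p))"
      unfolding f'_def using p q pq s fF transport_comp[of p ?s q "f p"] by auto
    also have "\<tau> p ?s (f p) = g ?s" using fD[OF p sB(2) s(2)] agree sB by simp
    also have "\<tau> ?s q (g ?s) = g q" using gD sB(1) q(1) s(3) by blast
    finally show ?thesis using f'B q by simp
  qed
  have "\<tau> p q (f' p) = f' q" if pq: "p \<in> strip (I \<union> B)" "q \<in> strip (I \<union> B)" "comparable p q" for p q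
  proof -
    have qp: "comparable q p" using pq by (auto simp: comparable_def)
    consider "fst p \<in> I" "fst q \<in> I" | "fst p \<in> I" "fst q \<notin> I" | "fst p \<notin> I" "fst q \<in> I"
      | "fst p \<notin> I" "fst q \<notin> I" by blast
    then show ?thesis
    proof cases
      case 1
      then show ?thesis using pq fD[of p q] unfolding f'_def by auto
    next
      case 2
      then show ?thesis using pq across[of p q] by auto
    next
      case 3
      then have "\<tau> q p (f' q) = f' p" using pq qp across[of q p] by auto
      then show ?thesis using transport_sym[OF _ _ qp f'F[OF pq(2)]] pq by auto
    next
      case 4
      then show ?thesis using pq gD[of p q] f'B by auto
    qed
  qed
  then have "flat_section (strip (I \<union> B)) f'" unfolding flat_section_def using f'F by blast
  moreover have "order_convex (I \<union> B)"
    by (rule order_convex_Un[OF conv, of _ "fst y"]) (use y in \<open>auto simp: B_def order_convex_def\<close>)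
  moreover have "fst z \<in> I \<union> B" unfolding B_def by simp
  moreover have "f' p = f p" if "p \<in> strip I" for p using that unfolding f'_def by simp
  ultimately show ?thesis using that by blast
qed

text \<open>
  \<open>T\<close> is transport in the total space of the local system. If \<open>(p, x)\<close> is transported to \<open>(q, y)\<close>, some
  flat section over a strip takes the value \<open>x\<close> at \<open>p\<close> and \<open>y\<close> at \<open>q\<close>; for \<open>q = p\<close> this forces \<open>y = x\<close>.
  Hence each point carries exactly one vector to which \<open>(c, v)\<close> can be transported.
\<close>

theorem flat_section_exists:
  assumes conn: "order_connected J" and c: "c \<in> J" and v: "v \<in> F c"
  obtains f where "flat_section J f" "f c = v"
proof -
  define T where
    "T = (\<lambda>(p, x) (q, y). p \<in> J \<and> q \<in> J \<and> comparable p q \<and> x \<in> F p \<and> \<tau> p q x = y)"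
  have T_flat: "\<exists>I f. order_convex I \<and> flat_section (strip I) f \<and> p \<in> strip I \<and> q \<in> strip I \<and> f p = x \<and> f q = y"
    if "T\<^sup>*\<^sup>* (p, x) (q, y)" "p \<in> J" "x \<in> F p" for p x q y
    using that
  proof (induction "(q, y)" arbitrary: q y rule: rtranclp_induct)
    case base
    let ?f = "\<lambda>q. \<tau> (fst q, snd p) q (\<tau> p (fst q, snd p) x)"
    have "flat_section (strip {fst p..fst p}) ?f"
      using flat_section_between[of p p x] base by (simp add: comparable_def)
    moreover have "order_convex {fst p..fst p}" by (auto simp: order_convex_def)
    moreover have "?f p = x" using base transport_id[of p x] by simp
    ultimately show ?case using base by (intro exI[of _ "{fst p..fst p}"] exI[of _ ?f]) auto
  next
    case (step q')
    obtain q0 y0 where q0: "q' = (q0, y0)" by fastforce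
    with step obtain I f where I: "order_convex I" "flat_section (strip I) f" "p \<in> strip I" "q0 \<in> strip I"
        "f p = x" "f q0 = y0" by blast
    have T: "q \<in> J" "comparable q0 q" "\<tau> q0 q y0 = y" using step(2) unfolding T_def q0 by auto
    obtain I' f' where I': "order_convex I'" "flat_section (strip I') f'" "I \<subseteq> I'" "fst q \<in> I'"
        "\<And>p. p \<in> strip I \<Longrightarrow> f' p = f p"
      by (rule flat_section_extend[OF I(1,2,4) T(1,2)]) (rule that)
    have in': "p \<in> strip I'" "q0 \<in> strip I'" "q \<in> strip I'" using I I' T by auto
    then have "\<tau> q0 q (f' q0) = f' q" using I'(2) T(2) unfolding flat_section_def by blast
    then have "f' q = y" using I'(5)[OF I(4)] I(6) T(3) by simp
    moreover have "f' p = x" using I' I by simp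
    ultimately show ?case using I' in' by blast
  qed
  have T_in: "q \<in> J \<and> y \<in> F q" if "T\<^sup>*\<^sup>* (c, v) (q, y)" for q y
    using that
    by (induction "(q, y)" arbitrary: q y rule: rtranclp_induct) (use c v in \<open>auto simp: T_def transport_in\<close>)
  have T_sym: "T\<^sup>*\<^sup>* b a" if "T\<^sup>*\<^sup>* a b" for a b
  proof (rule sympD[OF symp_rtranclp that], rule sympI)
    fix a b assume "T a b"
    then show "T b a"
      using transport_sym transport_in unfolding T_def by (auto simp: comparable_def split: prod.splits)
  qed
  have "\<exists>!x. T\<^sup>*\<^sup>* (c, v) (p, x)" if "p \<in> J" for p
  proof (rule ex_ex1I)
    show "\<exists>x. T\<^sup>*\<^sup>* (c, v) (p, x)"
      using conn c that
    proof (induction rule: order_connected_induct)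
      case (step p q)
      then obtain x where x: "T\<^sup>*\<^sup>* (c, v) (p, x)" by blast
      moreover have "T (p, x) (q, \<tau> p q x)" using T_in[OF x] step unfolding T_def by simp
      ultimately show ?case by (meson rtranclp.rtrancl_into_rtrancl)
    qed blast
  next
    fix x x' assume x: "T\<^sup>*\<^sup>* (c, v) (p, x)" and x': "T\<^sup>*\<^sup>* (c, v) (p, x')"
    have "T\<^sup>*\<^sup>* (p, x) (p, x')" using T_sym[OF x] x' by (rule rtranclp_trans)
    then show "x = x'" using T_flat[of p x p x'] T_in[OF x] by blast
  qed
  then obtain f where f: "\<And>p. p \<in> J \<Longrightarrow> T\<^sup>*\<^sup>* (c, v) (p, f p)"
    and f_unique: "\<And>p x. p \<in> J \<Longrightarrow> T\<^sup>*\<^sup>* (c, v) (p, x) \<Longrightarrow> x = f p"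
    by metis
  have "flat_section J f"
    unfolding flat_section_def
  proof (intro conjI ballI impI)
    fix p q assume pq: "p \<in> J" "q \<in> J" "comparable p q"
    have "T (p, f p) (q, \<tau> p q (f p))" using T_in[OF f] pq unfolding T_def by simp
    then have "T\<^sup>*\<^sup>* (c, v) (q, \<tau> p q (f p))" using f[OF pq(1)] by (rule rtranclp.rtrancl_into_rtrancl[rotated])
    then show "\<tau> p q (f p) = f q" using f_unique pq by blast
  qed (use T_in f in blast)
  moreover have "f c = v" using f_unique[OF c, of v] by simp
  ultimately show ?thesis using that by blast
qed

end

section \<open>Isomorphisms of vector spaces\<close>

lemma linear_mapI:
  assumes "vectorspace K V" "vectorspace K W"
    and "\<And>x. x \<in> carrier V \<Longrightarrow> f x \<in> carrier W"
    and "\<And>x y. x \<in> carrier V \<Longrightarrow> y \<in> carrier V \<Longrightarrow> f (x \<oplus>\<^bsub>V\<^esub> y) = f x \<oplus>\<^bsub>W\<^esub> f y"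
    and "\<And>c x. c \<in> carrier K \<Longrightarrow> x \<in> carrier V \<Longrightarrow> f (c \<odot>\<^bsub>V\<^esub> x) = c \<odot>\<^bsub>W\<^esub> f x"
  shows "linear_map K V W f"
  using assms
  by (auto simp: linear_map_def mod_hom_def mod_hom_axioms_def module_hom_def vectorspace_def)

lemma vs_iso_inv:
  assumes "vs_iso K V W f"
  shows "vs_iso K W V (inv_into (carrier V) f)"
proof -
  interpret linear_map K V W f using assms by (simp add: vs_iso_def)
  let ?g = "inv_into (carrier V) f"
  have bij: "bij_betw f (carrier V) (carrier W)" using assms by (simp add: vs_iso_def)
  have g: "?g y \<in> carrier V" "f (?g y) = y" if "y \<in> carrier W" for y
    using that bij by (auto simp: bij_betw_def inv_into_into f_inv_into_f)
  have gf: "?g y = x" if "x \<in> carrier V" "f x = y" for x y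
    using that bij by (auto simp: bij_betw_def)
  have "linear_map K W V ?g"
  proof (rule linear_mapI)
    show "vectorspace K W" "vectorspace K V" by unfold_locales
  qed (auto intro!: gf simp: g V.module.smult_closed)
  then show ?thesis using bij by (simp add: vs_iso_def bij_betw_inv_into)
qed

lemma vs_iso_fin_dim:
  assumes "vs_iso K V W f" "vectorspace.fin_dim K V"
  shows "vectorspace.fin_dim K W"
  using linear_map.surj_fin_dim[of K V W f] assms by (simp add: vs_iso_def bij_betw_def)

section \<open>Limits over a chamber\<close>

context pfd_pers_mod
begin

definition transport :: "'p \<Rightarrow> 'p \<Rightarrow> 'v \<Rightarrow> 'v"
  where "transport p q = (if p \<le> q then str M p q else inv_into (carrier (obj M q)) (str M q p))"

text \<open>
  Three pairwise comparable points form a chain, and of the three relations between vectors over a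
  chain any two imply the third: two by functoriality, one by injectivity as well.
\<close>

lemma local_system_transport:
  assumes iso: "\<And>a b. a \<in> J \<Longrightarrow> b \<in> J \<Longrightarrow> a \<le> b \<Longrightarrow> vs_iso K (obj M a) (obj M b) (str M a b)"
  shows "local_system J (\<lambda>p. carrier (obj M p)) transport"
proof -
  let ?F = "\<lambda>p. carrier (obj M p)"
  have bij: "bij_betw (str M a b) (?F a) (?F b)" if "a \<in> J" "b \<in> J" "a \<le> b" for a b
    using iso[OF that] by (simp add: vs_iso_def)
  have down: "transport p q x = y \<longleftrightarrow> str M q p y = x"
    if "p \<in> J" "q \<in> J" "q \<le> p" "x \<in> ?F p" "y \<in> ?F q" for p q x y
  proof (cases "p = q")
    case True
    then show ?thesis using that by (auto simp: transport_def str_id)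
  next
    case False
    then have "\<not> p \<le> q" using that by order
    then show ?thesis
      using that bij[OF that(2,1,3)]
      by (auto simp: transport_def bij_betw_def f_inv_into_f)
  qed
  have inj: "x = y" if "p \<in> J" "q \<in> J" "p \<le> q" "x \<in> ?F p" "y \<in> ?F p" "str M p q x = str M p q y"
    for p q x y
    using bij[OF that(1-3)] that(4-) by (auto simp: bij_betw_def dest: inj_onD)
  have t_in: "transport p q x \<in> ?F q" if "p \<in> J" "q \<in> J" "comparable p q" "x \<in> ?F p" for p q x
  proof (cases "p \<le> q")
    case False
    then show ?thesis
      using that bij[of q p] by (auto simp: transport_def comparable_def bij_betw_def inv_into_into)
  qed (use that str_in in \<open>simp add: transport_def\<close>)
  show ?thesis
  proof
    fix p q r x
    assume J: "p \<in> J" "q \<in> J" "r \<in> J" and c: "comparable p q" "comparable q r" "comparable p r"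
      and x: "x \<in> ?F p"
    define y where "y = transport p q x"
    define z where "z = transport q r y"
    have y: "y \<in> ?F q" using t_in J c x unfolding y_def by blast
    have z: "z \<in> ?F r" using t_in J c y unfolding z_def by blast
    have up: "transport a b = str M a b" if "a \<le> b" for a b using that by (simp add: transport_def)
    have xy: "(p \<le> q \<longrightarrow> str M p q x = y) \<and> (q \<le> p \<longrightarrow> str M q p y = x)"
      using down[OF J(1,2) _ x y] up unfolding y_def by simp
    have yz: "(q \<le> r \<longrightarrow> str M q r y = z) \<and> (r \<le> q \<longrightarrow> str M r q z = y)"
      using down[OF J(2,3) _ y z] up unfolding z_def by simp
    have "transport p r x = z"
    proof (cases "p \<le> r")
      case pr: True
      have "str M p r x = z"
      proof -
        consider "p \<le> q" "q \<le> r" | "q \<le> p" | "r \<le> q" using c unfolding comparable_def by blast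
        then show ?thesis
        proof cases
          case 1
          then show ?thesis using xy yz str_comp[OF _ _ x, of q r] by auto
        next
          case q: 2
          then have "q \<le> r" using pr by order
          then show ?thesis using xy yz q str_comp[OF q pr y] by auto
        next
          case r: 3
          then have "p \<le> q" using pr by order
          then have "str M r q (str M p r x) = str M r q z" using xy yz r str_comp[OF pr r x] by auto
          then show ?thesis using inj[OF J(3,2) r] str_in[OF pr x] z by blast
        qed
      qed
      then show ?thesis using up pr by simp
    next
      case False
      then have rp: "r \<le> p" using c unfolding comparable_def by blast
      have "str M r p z = x"
      proof -
        consider "r \<le> q" "q \<le> p" | "q \<le> r" | "p \<le> q" using c unfolding comparable_def by blast
        then show ?thesis
        proof cases
          case rq: 1
          then show ?thesis using xy yz str_comp[OF rq z] by auto
        next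
          case q: 2
          then have "q \<le> p" using rp by order
          then show ?thesis using xy yz q str_comp[OF q rp y] by auto
        next
          case p: 3
          then have "r \<le> q" using rp by order
          then have "str M p q (str M r p z) = str M p q x" using xy yz p str_comp[OF rp p z] by auto
          then show ?thesis using inj[OF J(1,2) p] str_in[OF rp z] x by blast
        qed
      qed
      then show ?thesis using down[OF J(1,3) rp x z] by blast
    qed
    then show "transport q r (transport p q x) = transport p r x" unfolding z_def y_def by simp
  qed (use t_in in \<open>auto simp: transport_def str_id\<close>)
qed

end

context pfd_pers_mod
begin

lemma bij_betw_leg:
  fixes J :: "'p set"
  assumes iso: "\<And>a b. a \<in> J \<Longrightarrow> b \<in> J \<Longrightarrow> a \<le> b \<Longrightarrow> vs_iso K (obj M a) (obj M b) (str M a b)"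
    and conn: "order_connected J" and j: "j \<in> J"
    and flat: "\<And>v. v \<in> carrier (obj M j) \<Longrightarrow>
      \<exists>f. local_system.flat_section (\<lambda>p. carrier (obj M p)) transport J f \<and> f j = v"
  shows "bij_betw (leg j) (carrier (lim_mod M J)) (carrier (obj M j))"
proof (rule bij_betwI')
  fix x y assume xy: "x \<in> carrier (lim_mod M J)" "y \<in> carrier (lim_mod M J)"
  have "x i = y i" if eq: "x j = y j" and i: "i \<in> J" for i
    using conn j i
  proof (induction rule: order_connected_induct)
    case (step p q)
    show ?case
    proof (cases "p \<le> q")
      case True
      then show ?thesis
        using lim_mod_str[OF xy(1) step(1,2) True] lim_mod_str[OF xy(2) step(1,2) True] step(4) by simp
    next
      case False
      then have le: "q \<le> p" using step(3) by (simp add: comparable_def)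
      have "inj_on (str M q p) (carrier (obj M q))"
        using iso[OF step(2,1) le] by (simp add: vs_iso_def bij_betw_def)
      moreover have "str M q p (x q) = str M q p (y q)"
        using lim_mod_str[OF xy(1) step(2,1) le] lim_mod_str[OF xy(2) step(2,1) le] step(4) by simp
      ultimately show ?thesis using lim_mod_in xy step(2) by (meson inj_onD)
    qed
  qed (rule eq)
  then show "(leg j x = leg j y) = (x = y)"
    using lim_mod_ext[OF xy] unfolding leg_def by blast
next
  fix x assume "x \<in> carrier (lim_mod M J)"
  then show "leg j x \<in> carrier (obj M j)" using lim_mod_in j unfolding leg_def by blast
next
  interpret local_system J "\<lambda>p. carrier (obj M p)" transport
    using iso by (rule local_system_transport)
  fix v assume "v \<in> carrier (obj M j)"
  then obtain f where f: "flat_section J f" "f j = v" using flat by blast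
  have "restrict f J \<in> carrier (lim_mod M J)"
    unfolding lim_mod_simps
  proof (intro conjI ballI impI)
    fix a b assume ab: "a \<in> J" "b \<in> J" "a \<le> b"
    then have "transport a b (f a) = f b"
      using f(1) unfolding flat_section_def comparable_def by blast
    then show "str M a b (restrict f J a) = restrict f J b" using ab by (simp add: transport_def)
  qed (use f(1) in \<open>auto simp: flat_section_def\<close>)
  moreover have "leg j (restrict f J) = v" using f(2) j by (simp add: leg_def)
  ultimately show "\<exists>x\<in>carrier (lim_mod M J). v = leg j x" by blast
qed

end

section \<open>The chamber model\<close>

locale plane_subdivision = pfd_pers_mod K M
  for K :: "('k, 'm) ring_scheme"
    and M :: "('a::{linorder,lattice} \<times> 'b::{linorder,lattice}, 'k, 'v) pers_mod" +
  fixes P :: "('a \<times> 'b) set set"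
  assumes subdivision: "isotopy_subdivision K M P"
    and convex_chamber: "J \<in> P \<Longrightarrow> order_convex J"
begin

abbreviation chamber :: "'a \<times> 'b \<Rightarrow> ('a \<times> 'b) set"
  where "chamber \<equiv> chamber_of P"

abbreviation Lim :: "'a \<times> 'b \<Rightarrow> ('k, 'a \<times> 'b \<Rightarrow> 'v) module"
  where "Lim p \<equiv> lim_mod M (chamber p)"

abbreviation model :: "('a \<times> 'b, 'k, 'a \<times> 'b \<Rightarrow> 'v) pers_mod"
  where "model \<equiv> chamber_model M P"

lemma chamber: "chamber p \<in> P" "p \<in> chamber p"
proof -
  have part: "partition_on UNIV P" using subdivision by (simp add: isotopy_subdivision_def)
  then have "\<exists>!J. J \<in> P \<and> p \<in> J"
    using partition_onD1[OF part] partition_onD2[OF part] unfolding disjoint_def by blast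
  then have "chamber p \<in> P \<and> p \<in> chamber p" unfolding chamber_of_def by (rule theI')
  then show "chamber p \<in> P" "p \<in> chamber p" by auto
qed

lemma chamber_disjoint: "chamber p \<noteq> chamber q \<Longrightarrow> chamber p \<inter> chamber q = {}"
  using subdivision chamber(1)[of p] chamber(1)[of q] disjointD[of P "chamber p" "chamber q"]
  by (simp add: isotopy_subdivision_def partition_on_def)

lemma chamber_connected: "order_connected (chamber p)"
  using subdivision chamber(1) unfolding isotopy_subdivision_def by blast

lemma chamber_iso:
  "a \<in> chamber p \<Longrightarrow> b \<in> chamber p \<Longrightarrow> a \<le> b \<Longrightarrow> vs_iso K (obj M a) (obj M b) (str M a b)"
  using subdivision chamber(1) unfolding isotopy_subdivision_def by blast

lemma leg_iso:
  assumes "j \<in> chamber p"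
  shows "vs_iso K (Lim p) (obj M j) (leg j)"
proof -
  interpret plane_local_system "chamber p" "\<lambda>i. carrier (obj M i)" transport
    using local_system_transport[OF chamber_iso] convex_chamber[OF chamber(1)]
    by (simp add: plane_local_system_def plane_local_system_axioms_def)
  have "\<exists>f. flat_section (chamber p) f \<and> f j = v" if "v \<in> carrier (obj M j)" for v
    using flat_section_exists[OF chamber_connected assms that] by blast
  then have "bij_betw (leg j) (carrier (Lim p)) (carrier (obj M j))"
    using chamber_iso by (intro bij_betw_leg[OF _ chamber_connected assms])
  then show ?thesis using linear_leg[OF assms] by (simp add: vs_iso_def)
qed

text \<open>
  Since every leg is injective, identities in a limit are checked at a single point of the chamber.
\<close>

lemma Lim_eqI:
  assumes "x \<in> carrier (Lim p)" "y \<in> carrier (Lim p)" "x p = y p"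
  shows "x = y"
  using leg_iso[OF chamber(2)[of p]] assms unfolding vs_iso_def bij_betw_def inj_on_def leg_def by blast

text \<open>
  For comparable pairs \<open>(a, b)\<close>, \<open>(a', b')\<close> the two squares of structure maps commute, and the map from
  \<open>M b\<close> to \<open>M b'\<close>, or back, is injective. The comparable pairs are connected.
\<close>

lemma transition_independent:
  assumes neq: "chamber p \<noteq> chamber q" and x: "x \<in> carrier (Lim p)" and y: "y \<in> carrier (Lim q)"
    and ab: "a \<in> chamber p" "b \<in> chamber q" "a \<le> b" and eq: "str M a b (x a) = y b"
    and ab': "a' \<in> chamber p" "b' \<in> chamber q" "a' \<le> b'"
  shows "str M a' b' (x a') = y b'"
proof -
  let ?E = "{(a, b). a \<in> chamber p \<and> b \<in> chamber q \<and> a \<le> b}"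
  have "order_connected ?E"
    by (intro coordinate_plane.order_connected_comparable_pairs convex_chamber chamber(1)
        chamber_connected chamber_disjoint neq)
  moreover have "(a, b) \<in> ?E" "(a', b') \<in> ?E" using ab ab' by auto
  ultimately have "case (a', b') of (a, b) \<Rightarrow> str M a b (x a) = y b"
  proof (induction rule: order_connected_induct)
    case (step s t)
    obtain a b a' b' where st: "s = (a, b)" "t = (a', b')" using prod.exhaust by metis
    have ab: "a \<in> chamber p" "b \<in> chamber q" "a \<le> b" and ab': "a' \<in> chamber p" "b' \<in> chamber q" "a' \<le> b'"
      using step(1,2) st by auto
    have eq: "str M a b (x a) = y b" using step(4) st by simp
    note xin = lim_mod_in[OF x] and yin = lim_mod_in[OF y]
    from step(3) consider "a \<le> a'" "b \<le> b'" | "a' \<le> a" "b' \<le> b"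
      unfolding st comparable_def by (auto simp: less_eq_prod_def)
    then have "str M a' b' (x a') = y b'"
    proof cases
      case 1
      have "str M a' b' (x a') = str M a' b' (str M a a' (x a))"
        using lim_mod_str[OF x ab(1) ab'(1) 1(1)] by simp
      also have "\<dots> = str M b b' (str M a b (x a))"
        using str_comp[OF 1(1) ab'(3)] str_comp[OF ab(3) 1(2)] xin ab(1) by simp
      also have "\<dots> = y b'"
        using eq lim_mod_str[OF y ab(2) ab'(2) 1(2)] by simp
      finally show ?thesis .
    next
      case 2
      have "str M b' b (str M a' b' (x a')) = str M a b (str M a' a (x a'))"
        using str_comp[OF 2(1) ab(3)] str_comp[OF ab'(3) 2(2)] xin ab'(1) by simp
      also have "\<dots> = str M b' b (y b')"
        using lim_mod_str[OF x ab'(1) ab(1) 2(1)] eq lim_mod_str[OF y ab'(2) ab(2) 2(2)] by simp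
      finally have "str M b' b (str M a' b' (x a')) = str M b' b (y b')" .
      moreover have "inj_on (str M b' b) (carrier (obj M b'))"
        using chamber_iso[OF ab'(2) ab(2) 2(2)] by (simp add: vs_iso_def bij_betw_def)
      ultimately show ?thesis
        using str_in[OF ab'(3) xin[OF ab'(1)]] yin[OF ab'(2)] by (meson inj_onD)
    qed
    then show ?case using st by simp
  qed (use eq in simp)
  then show ?thesis by simp
qed

text \<open>
  This describes the transition maps without the chosen pair and without distinguishing the cases of
  equal and of different chambers; by \<open>Lim_eqI\<close> it determines them. Functoriality, linearity and
  naturality are read off from it.
\<close>

lemma model_str:
  assumes le: "p \<le> q" and x: "x \<in> carrier (Lim p)"
  shows "str model p q x \<in> carrier (Lim q)" "str model p q x q = str M p q (x p)"
proof -
  have "str model p q x \<in> carrier (Lim q) \<and> str model p q x q = str M p q (x p)"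
  proof (cases "chamber p = chamber q")
    case True
    then have "q \<in> chamber p" using chamber(2)[of q] by simp
    then show ?thesis
      using True x lim_mod_str[OF x chamber(2) _ le] by (simp add: chamber_model_def)
  next
    case False
    define ab where "ab = (SOME (a, b). a \<in> chamber p \<and> b \<in> chamber q \<and> a \<le> b)"
    obtain a b where ab_eq: "ab = (a, b)" by (rule prod.exhaust)
    have "case ab of (a, b) \<Rightarrow> a \<in> chamber p \<and> b \<in> chamber q \<and> a \<le> b"
      unfolding ab_def by (rule someI[of _ "(p, q)"]) (use le chamber in auto)
    then have ab: "a \<in> chamber p" "b \<in> chamber q" "a \<le> b" unfolding ab_eq by auto
    define y where "y = inv_into (carrier (Lim q)) (leg b) (str M a b (x a))"
    have y_eq: "str model p q x = y"
      using False ab_eq unfolding ab_def y_def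
      by (simp add: chamber_model_def lim_transition_def leg_def)
    have bij: "bij_betw (leg b) (carrier (Lim q)) (carrier (obj M b))"
      using leg_iso[OF ab(2)] by (simp add: vs_iso_def)
    have v: "str M a b (x a) \<in> carrier (obj M b)"
      using str_in[OF ab(3) lim_mod_in[OF x ab(1)]] .
    have y: "y \<in> carrier (Lim q)" and yb: "leg b y = str M a b (x a)"
      using v bij unfolding y_def by (auto simp: bij_betw_def inv_into_into f_inv_into_f)
    have "str M p q (x p) = y q"
      using transition_independent[OF False x y ab _ chamber(2) chamber(2) le] yb by (simp add: leg_def)
    then show ?thesis using y y_eq by simp
  qed
  then show "str model p q x \<in> carrier (Lim q)" "str model p q x q = str M p q (x p)" by auto
qed

lemma obj_model: "obj model p = Lim p"
  by (simp add: chamber_model_def)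

lemma linear_model_str:
  assumes "p \<le> q"
  shows "linear_map K (Lim p) (Lim q) (str model p q)"
proof (rule linear_mapI)
  note q = chamber(2)[of q] and p = chamber(2)[of p]
  fix x y assume x: "x \<in> carrier (Lim p)" and y: "y \<in> carrier (Lim p)"
  show "str model p q (x \<oplus>\<^bsub>Lim p\<^esub> y) = str model p q x \<oplus>\<^bsub>Lim q\<^esub> str model p q y"
    using x y assms lim_mod_in[OF x p] lim_mod_in[OF y p]
    by (intro Lim_eqI[of _ q])
      (simp_all add: model_str lim_mod_add_in lim_mod_apply[OF q] lim_mod_apply[OF p] str_add)
next
  note q = chamber(2)[of q] and p = chamber(2)[of p]
  fix c x assume c: "c \<in> carrier K" and x: "x \<in> carrier (Lim p)"
  show "str model p q (c \<odot>\<^bsub>Lim p\<^esub> x) = c \<odot>\<^bsub>Lim q\<^esub> str model p q x"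
    using c x assms lim_mod_in[OF x p]
    by (intro Lim_eqI[of _ q])
      (simp_all add: model_str lim_mod_smult_in lim_mod_apply[OF q] lim_mod_apply[OF p] str_smult)
qed (use assms in \<open>auto simp: vectorspace_lim_mod model_str\<close>)

theorem pfd_model: "pfd_pers_mod K model"
proof (rule pfd_pers_mod.intro)
  fix p
  show "vectorspace K (obj model p)" by (simp add: obj_model vectorspace_lim_mod)
  have "vs_iso K (obj M p) (Lim p) (inv_into (carrier (Lim p)) (leg p))"
    by (rule vs_iso_inv[OF leg_iso[OF chamber(2)]])
  then show "vectorspace.fin_dim K (obj model p)"
    unfolding obj_model using fin_dim_obj by (rule vs_iso_fin_dim)
next
  fix p q :: "'a \<times> 'b" assume "p \<le> q"
  then show "linear_map K (obj model p) (obj model q) (str model p q)"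
    by (simp add: obj_model linear_model_str)
next
  fix p x assume "x \<in> carrier (obj model p)"
  then show "str model p p x = x" by (simp add: chamber_model_def)
next
  fix p q r x assume le: "p \<le> q" "q \<le> r" and "x \<in> carrier (obj model p)"
  then have x: "x \<in> carrier (Lim p)" by (simp add: obj_model)
  have pr: "p \<le> r" using le by (rule order_trans)
  show "str model q r (str model p q x) = str model p r x"
    by (rule Lim_eqI[of _ r])
      (use x le pr str_comp[OF le lim_mod_in[OF x chamber(2)]] in \<open>simp_all add: model_str\<close>)
qed

theorem isomorphic_model: "pers_mod_isomorphic K M model"
proof -
  define \<eta> where "\<eta> p = inv_into (carrier (Lim p)) (leg p)" for p
  have iso: "vs_iso K (obj M p) (Lim p) (\<eta> p)" for p
    unfolding \<eta>_def by (rule vs_iso_inv[OF leg_iso[OF chamber(2)]])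
  have \<eta>: "\<eta> p v \<in> carrier (Lim p)" "\<eta> p v p = v" if "v \<in> carrier (obj M p)" for p v
    using that leg_iso[OF chamber(2)[of p]] f_inv_into_f[of v "leg p" "carrier (Lim p)"]
    unfolding \<eta>_def vs_iso_def bij_betw_def by (auto simp: inv_into_into leg_def)
  have "\<eta> q (str M p q v) = str model p q (\<eta> p v)" if "p \<le> q" "v \<in> carrier (obj M p)" for p q v
    by (rule Lim_eqI[of _ q]) (use that in \<open>simp_all add: \<eta> model_str str_in\<close>)
  then show ?thesis
    unfolding pers_mod_isomorphic_def using iso by (intro exI[of _ \<eta>]) (simp add: obj_model)
qed

end

theorem theorem1:
  fixes K :: "('k, 'm) ring_scheme"
    and M :: "(real \<times> real, 'k, 'v) pers_mod"
    and P :: "(real \<times> real) set set"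
  assumes "field K"
    and "pfd_pers_mod K M"
    and "isotopy_subdivision K M P"
    and "finite P"
    and "\<forall>J\<in>P. order_convex J"
  shows "pfd_pers_mod K (chamber_model M P) \<and> pers_mod_isomorphic K M (chamber_model M P)"
proof -
  interpret plane_subdivision K M P
    using assms by (simp add: plane_subdivision_def plane_subdivision_axioms_def)
  show ?thesis using pfd_model isomorphic_model by blast
qed

end
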